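(* For all non-negative integers $b$ and $n$, \[ \zeta(4,\{2\}_n)=\sum_{l=0}^n(-1)^l\,\zeta^\star(\{2\}_l,4)\,\zeta(\{2\}_{n-l}), \] and \[ \zeta^\star(\{2\}_b,4)=2\bar\zeta(2b+4)+4\sum_{n=1}^\infty \frac{H_n^2}{n^{2b+2}}(-1)^{n-1}-4\sum_{n=1}^\infty\frac{H_n}{n^{2b+3}}(-1)^{n-1}, \] where $\zeta(\{2\}_k)=\frac{\pi^{2k}}{(2k+1)!}$.
   Context: Multiple zeta values: $\zeta(s_1,\dots,s_k)=\sum_{n_1>n_2>\cdots>n_k\ge1}\prod_j n_j^{-s_j}$ and multiple zeta star values $\zeta^\star(s_1,\dots,s_k)=\sum_{n_1\ge n_2\ge\cdots\ge n_k\ge1}\prod_j n_j^{-s_j}$ ($s_1\ge2$); the empty value is $1$. $\{2\}_k$ denotes the string $2,2,\dots,2$ ($k$ times), so e.g. $\zeta^\star(\{2\}_l,4)$ has $l$ twos followed by a $4$. $H_n=\sum_{j=1}^n 1/j$, and $\bar\zeta(s)=\sum_{n\ge1}(-1)^{n-1}n^{-s}$ is the alternating zeta (Dirichlet eta) function. *)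

theory Defs
  imports "HOL-Analysis.Analysis"
begin

text \<open>
  A summation index is the list \<open>ns = [n\<^sub>1, \<dots>, n\<^sub>k]\<close>, matching the argument list
  \<open>s = [s\<^sub>1, \<dots>, s\<^sub>k]\<close> entry by entry. The terms are nonnegative, so the unordered sum
  is the iterated one; it converges when \<open>s\<close> is empty or \<open>s\<^sub>1 \<ge> 2\<close> and all
  other entries are positive.
\<close>

definition mzv :: "nat list \<Rightarrow> real" where
  "mzv s = (\<Sum>\<^sub>\<infinity>ns \<in> {ns :: nat list. length ns = length s \<and> sorted_wrt (>) ns \<and> (\<forall>n \<in> set ns. n \<ge> 1)}.
              \<Prod>j<length s. 1 / real (ns ! j) ^ (s ! j))"

definition mzv_star :: "nat list \<Rightarrow> real" where
  "mzv_star s = (\<Sum>\<^sub>\<infinity>ns \<in> {ns :: nat list. length ns = length s \<and> sorted_wrt (\<ge>) ns \<and> (\<forall>n \<in> set ns. n \<ge> 1)}.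
              \<Prod>j<length s. 1 / real (ns ! j) ^ (s ! j))"

text \<open>The alternating series run over \<open>m = n - 1\<close>, so that \<open>m\<close> starts at 0.\<close>

definition alt_zeta :: "nat \<Rightarrow> real" where
  "alt_zeta s = (\<Sum>m. (- 1) ^ m / real (Suc m) ^ s)"

lemma mzv_Nil: "mzv [] = 1"
proof -
  have "{ns :: nat list. length ns = length ([] :: nat list) \<and> sorted_wrt (>) ns \<and> (\<forall>n \<in> set ns. n \<ge> 1)} = {[]}"
    by auto
  then show ?thesis by (simp add: mzv_def)
qed

lemma mzv_star_Nil: "mzv_star [] = 1"
proof -
  have "{ns :: nat list. length ns = length ([] :: nat list) \<and> sorted_wrt (\<ge>) ns \<and> (\<forall>n \<in> set ns. n \<ge> 1)} = {[]}"
    by auto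
  then show ?thesis by (simp add: mzv_star_def)
qed

end

theory Submission
  imports Defs "HOL-Complex_Analysis.Cauchy_Integral_Formula" "HOL-Real_Asymp.Real_Asymp"
begin

text \<open>
  All three identities are limits of finite ones for the sums truncated at \<open>n\<^sub>1 \<le> N\<close>.

  The convolution formula holds for every \<open>N\<close> by induction on \<open>N\<close>: the strict and the star
  recurrences in \<open>N\<close> produce correction terms that cancel.

  For the star value put \<open>c(N,k) = N!\<^sup>2 / ((N-k)! (N+k)!)\<close>. Since
  \<open>c(N,k) - c(N-1,k) = c(N,k) k\<^sup>2 / N\<^sup>2\<close>, every additional 2 in the argument string divides the
  \<open>k\<close>-th term of a sum weighted by \<open>c(N,k)\<close> by \<open>k\<^sup>2\<close>. It remains to see that
  \<open>2 \<Sum>\<^sub>k (-1)\<^sup>k\<^sup>-\<^sup>1 c(N,k) (H\<^sub>k\<^sup>2 + H\<^sub>k\<^sub>-\<^sub>1\<^sup>2) = 1/N\<^sup>2\<close>, which follows by two summations by parts.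
  As \<open>c(N,k)\<close> lies in \<open>[0,1]\<close> and tends to 1, Tannery's theorem gives the limit, and
  \<open>H\<^sub>k\<^sub>-\<^sub>1 = H\<^sub>k - 1/k\<close> turns it into the stated series.

  The values at strings of twos are the Taylor coefficients in Euler's product for the sine.
\<close>

section \<open>Truncated nested sums and their limits\<close>

text \<open>The gap \<open>d\<close> is 1 for the strict sums and 0 for the star sums.\<close>

primrec ztrunc :: "nat \<Rightarrow> nat list \<Rightarrow> nat \<Rightarrow> real" where
  "ztrunc d [] N = 1"
| "ztrunc d (a # s) N = (\<Sum>n=1..N. ztrunc d s (n - d) / real n ^ a)"

definition zindex :: "nat \<Rightarrow> nat \<Rightarrow> nat \<Rightarrow> nat list set" where
  "zindex d k N = {ns. length ns = k \<and> sorted_wrt (\<lambda>x y. y + d \<le> x) ns \<and> set ns \<subseteq> {1..N}}"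

lemma zindex_0: "zindex d 0 N = {[]}"
  by (auto simp: zindex_def)

text \<open>The head \<open>n\<close> bounds every later entry by \<open>n - d\<close>. If
  \<open>n \<le> d\<close>, truncated subtraction makes \<open>{1..n - d}\<close> empty, which is
  right because then no positive entry can follow.\<close>

lemma zindex_Suc:
  "zindex d (Suc k) N = (\<lambda>(n, ms). n # ms) ` (SIGMA n:{1..N}. zindex d k (n - d))"
proof (intro equalityI subsetI)
  fix ns assume "ns \<in> zindex d (Suc k) N"
  then obtain n ms where ns: "ns = n # ms" and "length ms = k" "n \<in> {1..N}"
    "sorted_wrt (\<lambda>x y. y + d \<le> x) ms" "\<forall>y\<in>set ms. y + d \<le> n" "set ms \<subseteq> {1..N}"
    by (cases ns) (auto simp: zindex_def)
  then have "(n, ms) \<in> (SIGMA n:{1..N}. zindex d k (n - d))"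
    by (fastforce simp: zindex_def)
  then show "ns \<in> (\<lambda>(n, ms). n # ms) ` (SIGMA n:{1..N}. zindex d k (n - d))"
    using ns by force
next
  fix ns assume "ns \<in> (\<lambda>(n, ms). n # ms) ` (SIGMA n:{1..N}. zindex d k (n - d))"
  then obtain n ms where "ns = n # ms" "n \<in> {1..N}" "ms \<in> zindex d k (n - d)"
    by auto
  moreover from this have "\<forall>y\<in>set ms. 1 \<le> y \<and> y + d \<le> n"
    by (fastforce simp: zindex_def)
  ultimately show "ns \<in> zindex d (Suc k) N"
    by (fastforce simp: zindex_def)
qed

lemma finite_zindex: "finite (zindex d k N)"
  by (rule finite_subset[OF _ finite_lists_length_eq[of "{1..N}" k]]) (auto simp: zindex_def)

lemma sum_zindex:
  "(\<Sum>ns\<in>zindex d (length s) N. \<Prod>j<length s. 1 / real (ns ! j) ^ (s ! j)) = ztrunc d s N"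
proof (induction s arbitrary: N)
  case Nil
  then show ?case by (simp add: zindex_0)
next
  case (Cons a s)
  have inj: "inj_on (\<lambda>(n, ms). n # ms) (SIGMA n:{1..N}. zindex d (length s) (n - d))"
    by (auto simp: inj_on_def)
  have "(\<Sum>ns\<in>zindex d (length (a # s)) N. \<Prod>j<length (a # s). 1 / real (ns ! j) ^ ((a # s) ! j))
      = (\<Sum>(n, ms)\<in>(SIGMA n:{1..N}. zindex d (length s) (n - d)).
           1 / real n ^ a * (\<Prod>j<length s. 1 / real (ms ! j) ^ (s ! j)))"
    unfolding length_Cons zindex_Suc sum.reindex[OF inj]
    by (simp add: case_prod_unfold prod.lessThan_Suc_shift del: prod.lessThan_Suc)
  also have "\<dots> = (\<Sum>n=1..N. 1 / real n ^ a * ztrunc d s (n - d))"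
    unfolding Cons.IH[symmetric] sum_distrib_left
    by (subst sum.Sigma[symmetric]) (auto simp: finite_zindex)
  finally show ?case by simp
qed

lemma ztrunc_nonneg: "0 \<le> ztrunc d s N"
  by (induction s arbitrary: N) (auto intro!: sum_nonneg)

text \<open>Subtracting \<open>1 / real N\<close> makes the bound inductive: each new term is at
  most the telescoping 1/N - 1/(N+1). The step from \<open>N = 0\<close> is separate because there
  \<open>1 / real N\<close> is 0.\<close>

lemma sum_inverse_squares_le: "(\<Sum>n=1..N. 1 / real n ^ 2) \<le> 2 - 1 / real N"
proof (induction N)
  case (Suc N)
  show ?case
  proof (cases "N = 0")
    case False
    then have "1 / real (Suc N) ^ 2 \<le> 1 / (real N * real (Suc N))"
      by (intro divide_left_mono) (auto simp: power2_eq_square)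
    also have "\<dots> = 1 / real N - 1 / real (Suc N)"
      using False by (simp add: field_simps)
    finally show ?thesis using Suc by simp
  qed simp
qed simp

text \<open>Each nesting level costs at most a factor 2, the bound on the sum of 1/n^2. Uniformity
  in \<open>N\<close> yields summability and later a geometric majorant.\<close>

lemma ztrunc_le:
  assumes "\<forall>a\<in>set s. 2 \<le> a"
  shows "ztrunc d s N \<le> 2 ^ length s"
  using assms
proof (induction s arbitrary: N)
  case (Cons a s)
  have "ztrunc d (a # s) N \<le> (\<Sum>n=1..N. 2 ^ length s * (1 / real n ^ 2))"
    unfolding ztrunc.simps
  proof (rule sum_mono)
    fix n assume n: "n \<in> {1..N}"
    have "ztrunc d s (n - d) / real n ^ a \<le> 2 ^ length s / real n ^ 2"
      using Cons n by (intro frac_le ztrunc_nonneg power_increasing) auto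
    then show "ztrunc d s (n - d) / real n ^ a \<le> 2 ^ length s * (1 / real n ^ 2)"
      by simp
  qed
  also have "\<dots> = 2 ^ length s * (\<Sum>n=1..N. 1 / real n ^ 2)"
    by (rule sum_distrib_left[symmetric])
  also have "\<dots> \<le> 2 ^ length s * 2"
    by (intro mult_left_mono order_trans[OF sum_inverse_squares_le]) auto
  finally show ?case by simp
qed simp

text \<open>Bounded finite sums of nonnegative terms give summability. The finite sets
  \<open>zindex d (length s) N\<close> eventually contain any given finite set of indices, so the
  infinite sum may be computed along them.\<close>

lemma ztrunc_tendsto:
  assumes "\<forall>a\<in>set s. 2 \<le> a"
  shows "ztrunc d s \<longlonglongrightarrow>
    (\<Sum>\<^sub>\<infinity>ns\<in>{ns. length ns = length s \<and> sorted_wrt (\<lambda>x y. y + d \<le> x) ns \<and> (\<forall>n\<in>set ns. n \<ge> 1)}.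
       \<Prod>j<length s. 1 / real (ns ! j) ^ (s ! j))"
    (is "_ \<longlonglongrightarrow> infsum ?f ?A")
proof -
  define f where "f = ?f"
  define A where "A = ?A"
  define I where "I = zindex d (length s)"
  have nonneg: "0 \<le> f ns" for ns
    unfolding f_def by (intro prod_nonneg) simp
  have sum_f: "sum f (I N) = ztrunc d s N" for N
    unfolding f_def I_def by (rule sum_zindex)
  have fin: "finite (I N)" for N
    unfolding I_def by (rule finite_zindex)
  have subset: "I N \<subseteq> A" for N
    by (auto simp: I_def A_def zindex_def)
  have exhaust: "\<forall>\<^sub>F N in sequentially. F \<subseteq> I N" if "finite F" "F \<subseteq> A" for F
  proof (rule eventually_sequentiallyI, rule subsetI)
    \<comment> \<open>The threshold is the largest entry of any list in \<open>F\<close>;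
      \<open>insert 0\<close> covers the case without entries.\<close>
    fix M ns assume M: "Max (insert 0 (\<Union>(set ` F))) \<le> M" and ns: "ns \<in> F"
    have "n \<le> M" if "n \<in> set ns" for n
      by (rule order_trans[OF Max_ge M]) (use that ns \<open>finite F\<close> in auto)
    moreover have "ns \<in> A"
      using ns \<open>F \<subseteq> A\<close> by (rule subsetD[rotated])
    ultimately show "ns \<in> I M"
      by (auto simp: I_def A_def zindex_def)
  qed
  have "f summable_on A"
  proof (rule nonneg_bdd_above_summable_on)
    show "bdd_above (sum f ` {F. F \<subseteq> A \<and> finite F})"
    proof (rule bdd_aboveI2)
      fix F assume "F \<in> {F. F \<subseteq> A \<and> finite F}"
      then obtain N where "F \<subseteq> I N"
        using exhaust[of F] by (auto dest: eventually_happens)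
      then have "sum f F \<le> sum f (I N)"
        by (intro sum_mono2 fin nonneg)
      also have "\<dots> \<le> 2 ^ length s"
        using ztrunc_le[OF assms] by (simp only: sum_f)
      finally show "sum f F \<le> 2 ^ length s" .
    qed
  qed (rule nonneg)
  then have "(f has_sum infsum f A) A"
    by (rule has_sum_infsum)
  then have "(sum f \<longlongrightarrow> infsum f A) (finite_subsets_at_top A)"
    by (simp only: has_sum_def)
  moreover have "filterlim I (finite_subsets_at_top A) sequentially"
    unfolding filterlim_finite_subsets_at_top using exhaust fin subset by simp
  ultimately have "(\<lambda>N. sum f (I N)) \<longlonglongrightarrow> infsum f A"
    by (rule filterlim_compose)
  then show ?thesis
    unfolding sum_f unfolding f_def A_def .
qed

lemma ztrunc_tendsto_mzv:
  assumes "\<forall>a\<in>set s. 2 \<le> a"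
  shows "ztrunc 1 s \<longlonglongrightarrow> mzv s"
proof -
  have "(\<lambda>x y :: nat. y + 1 \<le> x) = (>)"
    by (auto simp: fun_eq_iff)
  with ztrunc_tendsto[OF assms, of 1] show ?thesis
    by (simp only: mzv_def)
qed

lemma ztrunc_tendsto_mzv_star:
  assumes "\<forall>a\<in>set s. 2 \<le> a"
  shows "ztrunc 0 s \<longlonglongrightarrow> mzv_star s"
  using ztrunc_tendsto[OF assms, of 0] by (simp only: mzv_star_def add_0_right)

section \<open>The convolution formula\<close>

lemma ztrunc_Cons_Suc:
  "ztrunc d (a # s) (Suc N) = ztrunc d (a # s) N + ztrunc d s (Suc N - d) / real (Suc N) ^ a"
  by simp

lemma ztrunc_convolution:
  "ztrunc 1 (4 # replicate n 2) N =
     (\<Sum>l\<le>n. (- 1) ^ l * ztrunc 0 (replicate l 2 @ [4]) N * ztrunc 1 (replicate (n - l) 2) N)"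
proof (induction N arbitrary: n)
  case 0
  have "ztrunc 0 (replicate l 2 @ [4]) 0 = 0" for l
    by (cases l) auto
  then show ?case by simp
next
  case (Suc N)
  define c where "c = 1 / real (Suc N) ^ 2"
  define E where "E k = ztrunc 1 (replicate k 2) N" for k
  define E' where "E' k = ztrunc 1 (replicate k 2) (Suc N)" for k
  define T where "T l = ztrunc 0 (replicate l 2 @ [4]) N" for l
  define T' where "T' l = ztrunc 0 (replicate l 2 @ [4]) (Suc N)" for l
  have E0: "E' 0 = E 0" and E1: "E' (Suc k) = E (Suc k) + c * E k" for k
    by (simp_all add: E_def E'_def c_def)
  have T0: "T' 0 = T 0 + c ^ 2" and T1: "T' (Suc l) = T (Suc l) + c * T' l" for l
    by (simp_all add: T_def T'_def c_def power_divide flip: power_mult)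
  have Z: "ztrunc 1 (4 # replicate n 2) (Suc N) = ztrunc 1 (4 # replicate n 2) N + c ^ 2 * E n"
    by (simp add: E_def c_def power_divide flip: power_mult)
  have IH: "ztrunc 1 (4 # replicate n 2) N = (\<Sum>l\<le>n. (- 1) ^ l * T l * E (n - l))"
    using Suc by (simp only: T_def E_def)
  have "(\<Sum>l\<le>n. (- 1) ^ l * T' l * E' (n - l)) = (\<Sum>l\<le>n. (- 1) ^ l * T l * E (n - l)) + c ^ 2 * E n"
  proof (cases n)
    case 0
    then show ?thesis by (simp add: E0 T0 algebra_simps)
  next
    case (Suc m)
    \<comment> \<open>\<open>E1\<close> involves the old \<open>E k\<close>, but \<open>T1\<close>
      the new \<open>T' l\<close>. Expanding \<open>E'\<close> first and \<open>T'\<close> second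
      therefore gives the same sum over \<open>T' l * E (m - l)\<close> twice, with opposite signs
      because of the index shift in \<open>(- 1) ^ l\<close>. Only \<open>c ^ 2 * E n\<close>,
      coming from \<open>T' 0\<close>, survives.\<close>
    have "(\<Sum>l\<le>n. (- 1) ^ l * T' l * E' (n - l)) =
          (\<Sum>l\<le>n. (- 1) ^ l * T' l * E (n - l)) + c * (\<Sum>l\<le>m. (- 1) ^ l * T' l * E (m - l))"
    proof -
      have "(\<Sum>l\<le>m. (- 1) ^ l * T' l * E' (n - l)) =
            (\<Sum>l\<le>m. (- 1) ^ l * T' l * E (n - l) + c * ((- 1) ^ l * T' l * E (m - l)))"
        by (intro sum.cong) (auto simp: Suc E1 Suc_diff_le algebra_simps)
      then show ?thesis
        by (simp add: Suc E0 sum.distrib sum_distrib_left)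
    qed
    moreover have "(\<Sum>l\<le>n. (- 1) ^ l * T' l * E (n - l)) =
          (\<Sum>l\<le>n. (- 1) ^ l * T l * E (n - l)) + c ^ 2 * E n - c * (\<Sum>l\<le>m. (- 1) ^ l * T' l * E (m - l))"
    proof -
      have "(\<Sum>l\<le>m. (- 1) ^ Suc l * T' (Suc l) * E (m - l)) =
            (\<Sum>l\<le>m. (- 1) ^ Suc l * T (Suc l) * E (m - l) - c * ((- 1) ^ l * T' l * E (m - l)))"
        by (intro sum.cong) (auto simp: T1 algebra_simps)
      then show ?thesis
        unfolding Suc sum.atMost_Suc_shift
        by (simp add: T0 sum_subtractf sum_distrib_left distrib_right)
    qed
    ultimately show ?thesis by simp
  qed
  then show ?case
    unfolding Z IH E'_def[symmetric] T'_def[symmetric] by simp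
qed

lemma mzv_convolution:
  "mzv (4 # replicate n 2) =
     (\<Sum>l\<le>n. (- 1) ^ l * mzv_star (replicate l 2 @ [4]) * mzv (replicate (n - l) 2))"
proof (rule LIMSEQ_unique)
  show "ztrunc 1 (4 # replicate n 2) \<longlonglongrightarrow> mzv (4 # replicate n 2)"
    by (rule ztrunc_tendsto_mzv) auto
  show "ztrunc 1 (4 # replicate n 2) \<longlonglongrightarrow>
     (\<Sum>l\<le>n. (- 1) ^ l * mzv_star (replicate l 2 @ [4]) * mzv (replicate (n - l) 2))"
    unfolding ztrunc_convolution
    by (intro tendsto_intros ztrunc_tendsto_mzv ztrunc_tendsto_mzv_star) auto
qed

section \<open>The weights \<open>cbin\<close> and their sums\<close>

text \<open>
  \<open>cbin N k = N!\<^sup>2 / ((N-k)! (N+k)!)\<close> for \<open>k \<le> N\<close>; the recursion makes it vanish for \<open>k > N\<close>.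
\<close>

primrec cbin :: "nat \<Rightarrow> nat \<Rightarrow> real" where
  "cbin N 0 = 1"
| "cbin N (Suc k) = cbin N k * (real N - real k) / (real N + real k + 1)"

lemma cbin_eq_0: "N < k \<Longrightarrow> cbin N k = 0"
proof (induction k)
  case (Suc k)
  then show ?case by (cases "k = N") auto
qed simp

lemma cbin_bounds: "0 \<le> cbin N k \<and> cbin N k \<le> 1"
proof (induction k)
  case (Suc k)
  show ?case
  proof (cases "k \<le> N")
    case True
    have "cbin N k * ((real N - real k) / (real N + real k + 1)) \<le> 1 * 1"
      using Suc True by (intro mult_mono) (auto simp: field_simps)
    then show ?thesis using Suc True by simp
  qed (simp add: cbin_eq_0)
qed simp

lemma cbin_tendsto: "(\<lambda>N. cbin N k) \<longlonglongrightarrow> 1"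
proof (induction k)
  case (Suc k)
  have "(\<lambda>N. (real N - real k) / (real N + real k + 1)) \<longlonglongrightarrow> 1"
    by real_asymp
  from tendsto_mult[OF Suc this] show ?case by simp
qed simp

text \<open>The multiplied-out form remains valid at \<open>k = Suc N\<close>, where both sides are
  0.\<close>

lemma cbin_Suc_left:
  "cbin (Suc N) k * (real (Suc N) ^ 2 - real k ^ 2) = cbin N k * real (Suc N) ^ 2"
proof (induction k)
  case (Suc k)
  have "cbin (Suc N) (Suc k) * (real (Suc N) ^ 2 - real (Suc k) ^ 2)
      = cbin (Suc N) k * (real N + 1 - real k) * (real N - real k)"
    by (simp add: divide_simps) (simp add: algebra_simps power2_eq_square)
  \<comment> \<open>Factoring the difference of squares as (N+1-k)(N+1+k) exposes the left side of
    the induction hypothesis.\<close>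
  also have "\<dots> = cbin (Suc N) k * (real (Suc N) ^ 2 - real k ^ 2) * (real N - real k) / (real N + real k + 1)"
    by (simp add: divide_simps) (simp add: algebra_simps power2_eq_square)
  also have "\<dots> = cbin N (Suc k) * real (Suc N) ^ 2"
    unfolding Suc by simp
  finally show ?case .
qed simp

text \<open>This is the star recurrence of \<open>ztrunc_Cons_Suc\<close> with exponent 2, now for
  weighted sums: dividing \<open>a m\<close> by the square of \<open>Suc m\<close> corresponds to
  prepending a 2.\<close>

lemma sum_cbin_Suc:
  "(\<Sum>m<Suc N. cbin (Suc N) (Suc m) * (a m / real (Suc m) ^ 2)) =
   (\<Sum>m<N. cbin N (Suc m) * (a m / real (Suc m) ^ 2)) +
   (\<Sum>m<Suc N. cbin (Suc N) (Suc m) * a m) / real (Suc N) ^ 2"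
proof -
  have "cbin (Suc N) (Suc m) * (a m / real (Suc m) ^ 2) =
        cbin N (Suc m) * (a m / real (Suc m) ^ 2) + cbin (Suc N) (Suc m) * a m / real (Suc N) ^ 2" for m
  proof -
    have "a m * (cbin (Suc N) (Suc m) * (real (Suc N) ^ 2 - real (Suc m) ^ 2)) =
          a m * (cbin N (Suc m) * real (Suc N) ^ 2)"
      by (simp only: cbin_Suc_left)
    then show ?thesis
      by (simp add: field_simps del: of_nat_Suc cbin.simps)
  qed
  then have "(\<Sum>m<Suc N. cbin (Suc N) (Suc m) * (a m / real (Suc m) ^ 2)) =
      (\<Sum>m<Suc N. cbin N (Suc m) * (a m / real (Suc m) ^ 2)) +
      (\<Sum>m<Suc N. cbin (Suc N) (Suc m) * a m / real (Suc N) ^ 2)"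
    by (simp only: sum.distrib)
  \<comment> \<open>The summand \<open>m = N\<close> drops out since
    \<open>cbin N (Suc N) = 0\<close>.\<close>
  then show ?thesis
    by (simp add: cbin_eq_0 sum_divide_distrib add_divide_distrib del: cbin.simps)
qed

text \<open>For powers of \<open>harm\<close> the factor \<open>real (Suc m)\<close> cancels the
  denominator of the increment, so each use lowers the degree in \<open>harm\<close> and gains a
  factor 1/N.\<close>

lemma sum_cbin_by_parts:
  "real N * (\<Sum>m<N. (- 1) ^ m * cbin N (Suc m) * (F (Suc m) + F m)) =
   (\<Sum>m<N. (- 1) ^ m * cbin N (Suc m) * (real (Suc m) * (F (Suc m) - F m))) + real N * F 0"
proof -
  txt \<open>For partial sums the difference of the two sides telescopes.\<close>
  have "real N * (\<Sum>m<K. (- 1) ^ m * cbin N (Suc m) * (F (Suc m) + F m)) =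
    (\<Sum>m<K. (- 1) ^ m * cbin N (Suc m) * (real (Suc m) * (F (Suc m) - F m))) + real N * F 0
     - (- 1) ^ K * (cbin N K * (real N - real K)) * F K" for K
  proof (induction K)
    case (Suc K)
    define S where "S = (\<Sum>m<K. (- 1) ^ m * cbin N (Suc m) * (F (Suc m) + F m))"
    define R where "R = (\<Sum>m<K. (- 1) ^ m * cbin N (Suc m) * (real (Suc m) * (F (Suc m) - F m)))"
    have step: "cbin N K * (real N - real K) = cbin N (Suc K) * (real N + real K + 1)"
      by simp
    have "real N * S = R + real N * F 0 - (- 1) ^ K * (cbin N (Suc K) * (real N + real K + 1)) * F K"
      using Suc unfolding step S_def R_def .
    then show ?case
      unfolding sum.lessThan_Suc S_def[symmetric] R_def[symmetric]
      by (simp add: algebra_simps del: cbin.simps)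
  qed simp
  \<comment> \<open>At \<open>K = N\<close> the boundary term contains the factor
    \<open>real N - real K = 0\<close>.\<close>
  from this[of N] show ?thesis by simp
qed

lemma sum_cbin_harm:
  assumes "0 < N"
  shows "(\<Sum>m<N. cbin N (Suc m) * (2 * (- 1) ^ m * (harm (Suc m) ^ 2 + harm m ^ 2))) = 1 / real N ^ 2"
proof -
  define S where "S f = (\<Sum>m<N. (- 1) ^ m * cbin N (Suc m) * f m)" for f :: "nat \<Rightarrow> real"
  have harm: "real (Suc m) * (harm (Suc m) - harm m) = 1" for m
    by (simp add: harm_Suc)
  have harm2: "real (Suc m) * (harm (Suc m) ^ 2 - harm m ^ 2) = harm (Suc m) + harm m" for m
  proof -
    have "real (Suc m) * (harm (Suc m) ^ 2 - harm m ^ 2) =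
          real (Suc m) * (harm (Suc m) - harm m) * (harm (Suc m) + harm m)"
      by (simp only: power2_eq_square) (simp add: algebra_simps)
    then show ?thesis by (simp only: harm mult_1)
  qed
  \<comment> \<open>The choices of \<open>F\<close> are 1, \<open>harm\<close> and its square. The
    term \<open>F 0\<close> is 1 for the first and 0 for the others; chaining the results gives 1/2,
    then 1/(2N), then 1/(2N^2).\<close>
  have 0: "2 * (real N * S (\<lambda>m. 1)) = real N"
    using sum_cbin_by_parts[of N "\<lambda>_. 1"] by (simp add: S_def sum_distrib_left mult_ac del: cbin.simps)
  have 1: "real N * S (\<lambda>m. harm (Suc m) + harm m) = S (\<lambda>m. 1)"
    using sum_cbin_by_parts[of N harm] by (simp only: harm S_def) (simp add: harm_expand)
  have 2: "real N * S (\<lambda>m. harm (Suc m) ^ 2 + harm m ^ 2) = S (\<lambda>m. harm (Suc m) + harm m)"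
    using sum_cbin_by_parts[of N "\<lambda>m. harm m ^ 2"] by (simp only: harm2 S_def) (simp add: harm_expand)
  have "2 * S (\<lambda>m. harm (Suc m) ^ 2 + harm m ^ 2) = 1 / real N ^ 2"
  proof -
    have "S (\<lambda>m. 1) = 1 / 2" using 0 assms by simp
    then have "S (\<lambda>m. harm (Suc m) + harm m) = 1 / 2 / real N"
      using 1 assms by (simp add: eq_divide_eq mult_ac)
    then have "S (\<lambda>m. harm (Suc m) ^ 2 + harm m ^ 2) = 1 / 2 / real N / real N"
      using 2 assms by (simp only: eq_divide_eq mult_ac) simp
    then show ?thesis by (simp add: power2_eq_square)
  qed
  then show ?thesis
    by (simp add: S_def sum_distrib_left mult_ac del: cbin.simps)
qed

section \<open>Evaluation of the star values\<close>

text \<open>Both sides vanish at \<open>N = 0\<close> and have the same increments in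
  \<open>N\<close>: by \<open>sum_cbin_harm\<close> for \<open>b = 0\<close>, and otherwise by the
  formula for one 2 fewer at \<open>Suc N\<close>. The final division by a square stays separate to
  match \<open>sum_cbin_Suc\<close>.\<close>

lemma ztrunc_star_eq_sum_cbin:
  "ztrunc 0 (replicate b 2 @ [4]) N =
     (\<Sum>m<N. cbin N (Suc m) *
        (2 * (- 1) ^ m * (harm (Suc m) ^ 2 + harm m ^ 2) / real (Suc m) ^ (2 * b) / real (Suc m) ^ 2))"
proof (induction b arbitrary: N)
  case 0
  show ?case
  proof (induction N)
    case (Suc N)
    have "1 / real (Suc N) ^ 2 / real (Suc N) ^ 2 = 1 / real (Suc N) ^ 4"
      by (simp flip: power_add del: of_nat_Suc)
    then show ?case
      using Suc sum_cbin_harm[of "Suc N"]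
      by (subst sum_cbin_Suc) (simp del: cbin.simps of_nat_Suc sum.lessThan_Suc)
  qed simp
next
  case (Suc b)
  note IH_b = Suc
  show ?case
  proof (induction N)
    case (Suc N)
    have IH: "ztrunc 0 (replicate b 2 @ [4]) (Suc N) = (\<Sum>m<Suc N. cbin (Suc N) (Suc m) *
        (2 * (- 1) ^ m * (harm (Suc m) ^ 2 + harm m ^ 2) / real (Suc m) ^ (2 * Suc b)))"
      unfolding IH_b
      by (simp add: power_add mult_ac power2_eq_square[of "real _"]
          del: cbin.simps of_nat_Suc sum.lessThan_Suc)
    show ?case
      unfolding replicate_Suc append_Cons ztrunc_Cons_Suc
      using Suc IH
      by (subst sum_cbin_Suc) (simp del: cbin.simps of_nat_Suc sum.lessThan_Suc)
  qed simp
qed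

text \<open>Provides the majorant for Tannery's theorem. The squared logarithm is absorbed by a
  power 1/2 of \<open>m\<close>, leaving the summable exponent -3/2.\<close>

lemma summable_harm_square: "summable (\<lambda>m. harm (Suc m) ^ 2 / real (Suc m) ^ 2)"
proof (rule summable_comparison_test_ev)
  show "summable (\<lambda>m. (1 + ln (real (Suc m))) ^ 2 / real (Suc m) ^ 2)"
  proof (rule summable_comparison_test_bigo)
    show "summable (\<lambda>m. norm (real m powr (- 3 / 2)))"
      by (simp add: summable_real_powr_iff)
    show "(\<lambda>m. (1 + ln (real (Suc m))) ^ 2 / real (Suc m) ^ 2) \<in> O(\<lambda>m. real m powr (- 3 / 2))"
      by real_asymp
  qed
  have "harm (Suc m) \<le> 1 + ln (real (Suc m))" for m
    using euler_mascheroni_sequence_decreasing[of 1 "Suc m"] by (simp add: harm_expand)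
  then show "\<forall>\<^sub>F m in sequentially. norm (harm (Suc m) ^ 2 / real (Suc m) ^ 2)
      \<le> (1 + ln (real (Suc m))) ^ 2 / real (Suc m) ^ 2"
    by (intro always_eventually allI) (auto intro!: divide_right_mono power_mono harm_nonneg)
qed

text \<open>Hence 1 and \<open>harm (Suc m)\<close> are at most the square of
  \<open>harm (Suc m)\<close>, and one majorant serves all three alternating series.\<close>

lemma harm_Suc_ge_1: "1 \<le> (harm (Suc m) :: real)"
proof (induction m)
  case (Suc m)
  then show ?case
    by (subst harm_Suc) (simp add: add_increasing2)
qed (simp add: harm_expand)

lemma mzv_star_eq_alternating_harm:
  "mzv_star (replicate b 2 @ [4]) =
     2 * alt_zeta (2 * b + 4)
     + 4 * (\<Sum>m. (harm (Suc m))\<^sup>2 / real (Suc m) ^ (2 * b + 2) * (- 1) ^ m)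
     - 4 * (\<Sum>m. harm (Suc m) / real (Suc m) ^ (2 * b + 3) * (- 1) ^ m)"
proof -
  define w where "w m = 2 * (- 1) ^ m * (harm (Suc m) ^ 2 + harm m ^ 2) / real (Suc m) ^ (2 * b)
     / real (Suc m) ^ 2" for m
  define A where "A m = (- 1) ^ m / real (Suc m) ^ (2 * b + 4)" for m
  define B where "B m = (harm (Suc m))\<^sup>2 / real (Suc m) ^ (2 * b + 2) * (- 1) ^ m" for m
  define C where "C m = harm (Suc m) / real (Suc m) ^ (2 * b + 3) * (- 1) ^ m" for m
  define M where "M m = harm (Suc m) ^ 2 / real (Suc m) ^ 2" for m
  have harm_sq: "harm (Suc m) \<le> (harm (Suc m) ^ 2 :: real)" "1 \<le> (harm (Suc m) ^ 2 :: real)" for m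
    using harm_Suc_ge_1[of m] by (simp_all add: self_le_power)
  have le_M: "x / real (Suc m) ^ j \<le> M m" if "2 \<le> j" "0 \<le> x" "x \<le> harm (Suc m) ^ 2" for x j m
    unfolding M_def using that by (intro frac_le power_increasing) auto
  have A: "norm (A m) \<le> M m" and B: "norm (B m) \<le> M m" and C: "norm (C m) \<le> M m" for m
    using le_M[of "2 * b + 4" 1 m] le_M[of "2 * b + 2" "harm (Suc m) ^ 2" m]
      le_M[of "2 * b + 3" "harm (Suc m)" m] harm_sq[of m] harm_nonneg[of "Suc m", where 'a = real]
    by (simp_all add: A_def B_def C_def abs_mult power_abs)
  have M: "summable M"
    using summable_harm_square by (simp only: M_def[abs_def])
  have sum: "summable A" "summable B" "summable C"
    by (rule summable_comparison_test'[OF M, of 0], rule A B C)+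
  have w: "w m = 2 * A m + 4 * B m - 4 * C m" for m
  proof -
    have "harm m = harm (Suc m) - 1 / real (Suc m)"
      by (simp add: harm_Suc inverse_eq_divide)
    then have "harm (Suc m) ^ 2 + harm m ^ 2 =
        2 * harm (Suc m) ^ 2 - 2 * harm (Suc m) / real (Suc m) + 1 / real (Suc m) ^ 2"
      by (simp only: power2_diff) (simp add: power_divide)
    then have "w m = 2 * (- 1) ^ m * (2 * harm (Suc m) ^ 2 - 2 * harm (Suc m) / real (Suc m) + 1 / real (Suc m) ^ 2)
       / real (Suc m) ^ (2 * b) / real (Suc m) ^ 2"
      by (simp only: w_def)
    moreover have "2 * e * (2 * h ^ 2 - 2 * h / x + 1 / x ^ 2) / x ^ (2 * b) / x ^ 2 =
      2 * (e / x ^ (2 * b + 4)) + 4 * (h ^ 2 / x ^ (2 * b + 2) * e) - 4 * (h / x ^ (2 * b + 3) * e)"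
      if "x \<noteq> 0" for e h x :: real
    proof -
      have "x ^ (2 * b + 4) = x ^ (2 * b) * x * x * x * x" "x ^ (2 * b + 3) = x ^ (2 * b) * x * x * x"
        "x ^ (2 * b + 2) = x ^ (2 * b) * x * x" "x ^ 2 = x * x"
        by (simp_all add: power_add numeral_eq_Suc)
      then show ?thesis
        using that by (simp only:) (simp add: field_simps)
    qed
    ultimately show ?thesis
      unfolding A_def B_def C_def by simp
  qed
  have w_le: "norm (w m) \<le> 10 * M m" for m
    using A[of m] B[of m] C[of m] unfolding w real_norm_def by linarith
  have bound: "norm (cbin N (Suc m) * w m) \<le> 10 * M m" for N m
  proof -
    have "norm (cbin N (Suc m) * w m) \<le> 1 * norm (w m)"
      unfolding norm_mult using cbin_bounds[of N "Suc m"] by (intro mult_right_mono) (auto simp del: cbin.simps)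
    then show ?thesis
      using w_le[of m] by linarith
  qed
  have "(\<lambda>N. \<Sum>m. cbin N (Suc m) * w m) \<longlonglongrightarrow> (\<Sum>m. w m)"
  proof (rule tannerys_theorem[THEN conjunct2, THEN conjunct2])
    show "(\<lambda>N. cbin N (Suc m) * w m) \<longlonglongrightarrow> w m" for m
      using tendsto_mult_right[OF cbin_tendsto[of "Suc m"], of "w m"] by simp
    show "\<forall>\<^sub>F (m, N) in sequentially \<times>\<^sub>F sequentially. norm (cbin N (Suc m) * w m) \<le> 10 * M m"
      using bound by (intro always_eventually) auto
  qed (use M in \<open>auto intro: summable_mult\<close>)
  \<comment> \<open>The series is a finite sum because \<open>cbin N k\<close> vanishes for
    \<open>k > N\<close>.\<close>
  moreover have "(\<Sum>m. cbin N (Suc m) * w m) = ztrunc 0 (replicate b 2 @ [4]) N" for N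
    unfolding ztrunc_star_eq_sum_cbin w_def[symmetric]
    by (rule suminf_finite) (auto simp: cbin_eq_0 simp del: cbin.simps)
  ultimately have "ztrunc 0 (replicate b 2 @ [4]) \<longlonglongrightarrow> (\<Sum>m. w m)"
    by simp
  moreover have "ztrunc 0 (replicate b 2 @ [4]) \<longlonglongrightarrow> mzv_star (replicate b 2 @ [4])"
    by (rule ztrunc_tendsto_mzv_star) auto
  ultimately have "mzv_star (replicate b 2 @ [4]) = (\<Sum>m. w m)"
    by (rule LIMSEQ_unique[rotated])
  also have "\<dots> = 2 * suminf A + 4 * suminf B - 4 * suminf C"
    unfolding w
    by (intro sums_unique[symmetric] sums_diff sums_add sums_mult summable_sums sum)
  finally show ?thesis
    by (simp only: A_def[abs_def] B_def[abs_def] C_def[abs_def] alt_zeta_def)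
qed

section \<open>Strings of twos and the sine product\<close>

text \<open>The coefficients are the elementary symmetric polynomials in 1/j^2 for j up to
  \<open>N\<close>.\<close>

lemma ztrunc_twos_generating:
  "(\<lambda>k. ztrunc 1 (replicate k 2) N * y ^ k) sums (\<Prod>j=1..N. 1 + y / real j ^ 2)"
proof (induction N)
  case 0
  have "(\<lambda>k. ztrunc 1 (replicate k 2) 0 * y ^ k) = (\<lambda>k. if k = 0 then 1 else 0)"
  proof
    fix k show "ztrunc 1 (replicate k 2) 0 * y ^ k = (if k = 0 then 1 else 0)"
      by (cases k) auto
  qed
  then show ?case
    using sums_single[of 0 "\<lambda>_. 1::real"] by simp
next
  case (Suc N)
  define c where "c = y / real (Suc N) ^ 2"
  define P where "P = (\<Prod>j=1..N. 1 + y / real j ^ 2)"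
  \<comment> \<open>Coefficients of the old series multiplied by \<open>c\<close>, moved up one
    place since \<open>c\<close> carries a factor \<open>y\<close>.\<close>
  define g where "g k = (case k of 0 \<Rightarrow> 0 | Suc i \<Rightarrow> c * (ztrunc 1 (replicate i 2) N * y ^ i))" for k
  have "(\<lambda>i. g (Suc i)) sums (c * P)"
    unfolding g_def P_def using sums_mult[OF Suc, of c] by simp
  then have "g sums (c * P)"
    by (subst (asm) sums_Suc_iff) (simp add: g_def)
  from sums_add[OF Suc[folded P_def] this]
  have "(\<lambda>k. ztrunc 1 (replicate k 2) N * y ^ k + g k) sums (P + c * P)" .
  moreover have "ztrunc 1 (replicate k 2) N * y ^ k + g k = ztrunc 1 (replicate k 2) (Suc N) * y ^ k" for k
    by (cases k) (simp_all add: g_def c_def algebra_simps)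
  moreover have "(\<Prod>j=1..Suc N. 1 + y / real j ^ 2) = P + c * P"
    by (simp add: P_def c_def algebra_simps)
  ultimately show ?case by simp
qed

text \<open>The bound \<open>2 ^ k\<close> from \<open>ztrunc_le\<close> gives a geometric majorant
  exactly when 2|y| < 1.\<close>

lemma mzv_twos_generating:
  fixes y :: real
  assumes "\<bar>y\<bar> < 1 / 2"
  shows "summable (\<lambda>k. mzv (replicate k 2) * y ^ k)"
    and "(\<lambda>N. \<Prod>j=1..N. 1 + y / real j ^ 2) \<longlonglongrightarrow> (\<Sum>k. mzv (replicate k 2) * y ^ k)"
proof -
  have M: "summable (\<lambda>k. (2 * \<bar>y\<bar>) ^ k)"
    using assms by (intro summable_geometric) auto
  have lim: "(\<lambda>N. ztrunc 1 (replicate k 2) N * y ^ k) \<longlonglongrightarrow> mzv (replicate k 2) * y ^ k" for k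
    by (intro tendsto_mult_right ztrunc_tendsto_mzv) auto
  have "norm (ztrunc 1 (replicate k 2) N * y ^ k) \<le> (2 * \<bar>y\<bar>) ^ k" for k N
    using ztrunc_le[of "replicate k 2" 1 N] ztrunc_nonneg[of 1 "replicate k 2" N]
    by (simp add: abs_mult power_abs power_mult_distrib mult_right_mono)
  then have bound: "\<forall>\<^sub>F (k, N) in sequentially \<times>\<^sub>F sequentially.
      norm (ztrunc 1 (replicate k 2) N * y ^ k) \<le> (2 * \<bar>y\<bar>) ^ k"
    by (intro always_eventually) auto
  note T = tannerys_theorem[OF lim bound M sequentially_bot]
  show "summable (\<lambda>k. mzv (replicate k 2) * y ^ k)"
    using T by (auto intro: summable_norm_cancel)
  show "(\<lambda>N. \<Prod>j=1..N. 1 + y / real j ^ 2) \<longlonglongrightarrow> (\<Sum>k. mzv (replicate k 2) * y ^ k)"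
    using T ztrunc_twos_generating[of _ y] by (simp add: sums_iff)
qed

text \<open>The sine series in the variable y = -x^2 of the generating function. At
  \<open>x = 0\<close> the quotient would be 0 in HOL, while the series sums to 1.\<close>

lemma sin_over_sums:
  fixes x :: real
  assumes "x \<noteq> 0"
  shows "(\<lambda>k. pi ^ (2 * k) / fact (2 * k + 1) * (- (x ^ 2)) ^ k) sums (sin (pi * x) / (pi * x))"
proof -
  have "(\<lambda>k. (- 1) ^ k / fact (2 * k + 1) * (pi * x) ^ (2 * k + 1) / (pi * x)) sums (sin (pi * x) / (pi * x))"
    by (intro sums_divide sin_paired)
  moreover have "(- 1) ^ k / fact (2 * k + 1) * (pi * x) ^ (2 * k + 1) / (pi * x) =
      pi ^ (2 * k) / fact (2 * k + 1) * (- (x ^ 2)) ^ k" for k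
  proof -
    have "(- (x ^ 2)) ^ k = (- 1) ^ k * x ^ (2 * k)"
      by (simp add: power_minus[of "x ^ 2"] power_mult)
    then show ?thesis
      using assms by (simp add: power_mult_distrib del: fact_Suc)
  qed
  ultimately show ?thesis by simp
qed

text \<open>Uniqueness of power series coefficients: the difference series \<open>f\<close> vanishes
  at all small negative arguments, whereas a nonzero coefficient would make its zero at 0
  isolated.\<close>

lemma mzv_twos: "mzv (replicate k 2) = pi ^ (2 * k) / fact (2 * k + 1)"
proof (rule ccontr)
  assume neq: "mzv (replicate k 2) \<noteq> pi ^ (2 * k) / fact (2 * k + 1)"
  define a where "a k = mzv (replicate k 2) - pi ^ (2 * k) / fact (2 * k + 1)" for k
  define f where "f y = (\<Sum>k. a k * y ^ k)" for y :: real
  have a: "(\<lambda>k. a k * (- (x ^ 2)) ^ k) sums 0" if "0 < x" "x ^ 2 < 1 / 2" for x :: real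
  proof -
    have y: "\<bar>- (x ^ 2)\<bar> < 1 / 2"
      using that by simp
    have "(\<lambda>N. \<Prod>j=1..N. 1 + - (x ^ 2) / real j ^ 2) \<longlonglongrightarrow> sin (pi * x) / (pi * x)"
      using sin_product_formula_real'[of x] that by simp
    then have "(\<Sum>k. mzv (replicate k 2) * (- (x ^ 2)) ^ k) = sin (pi * x) / (pi * x)"
      by (rule LIMSEQ_unique[OF mzv_twos_generating(2)[OF y]])
    then have "(\<lambda>k. mzv (replicate k 2) * (- (x ^ 2)) ^ k) sums (sin (pi * x) / (pi * x))"
      using mzv_twos_generating(1)[OF y] by (simp only: sums_iff)
    from sums_diff[OF this sin_over_sums[of x]] show ?thesis
      using that by (simp add: a_def left_diff_distrib)
  qed
  have a0: "a 0 = 0"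
    by (simp add: a_def mzv_Nil)
  \<comment> \<open>Convergence at y = -1/4, from \<open>x = 1/2\<close>, gives convergence for |y|
    < 1/4.\<close>
  have summable: "summable (\<lambda>k. a k * (- ((1 / 2) ^ 2)) ^ k)"
    by (rule sums_summable[OF a]) (auto simp: power2_eq_square)
  have sums: "(\<lambda>k. a k * (y - 0) ^ k) sums f y" if "norm (y - 0) < 1 / 4" for y
    unfolding f_def diff_0_right using that
    by (intro summable_sums powser_inside[OF summable]) (simp add: power2_eq_square)
  have f0: "f 0 = 0"
    unfolding f_def powser_zero by (rule a0)
  have ak: "a k \<noteq> 0"
    using neq unfolding a_def by (simp only: right_minus_eq not_False_eq_True)
  then have k: "0 < k"
    using a0 by (metis gr0I)
  have quarter: "(0::real) < 1 / 4"
    by simp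
  obtain s where s: "0 < s" "\<And>z. z \<in> cball 0 s - {0} \<Longrightarrow> f z \<noteq> 0"
    by (rule powser_0_nonzero[OF quarter sums f0 ak k]) (assumption, rule that)
  \<comment> \<open>Then -x^2 lies in the punctured ball of radius \<open>s\<close>, and x^2 < 1/2
    as required by \<open>a\<close>.\<close>
  define x where "x = sqrt (min s (1 / 4))"
  have "0 < x" "x ^ 2 \<le> s" "x ^ 2 < 1 / 2"
    using s by (auto simp: x_def)
  then have "f (- (x ^ 2)) \<noteq> 0"
    by (intro s) auto
  moreover have "f (- (x ^ 2)) = 0"
    using a[of x] \<open>0 < x\<close> \<open>x ^ 2 < 1 / 2\<close> by (simp add: f_def sums_iff)
  ultimately show False by simp
qed

theorem theorem3p10:
  fixes b n :: nat
  shows "mzv (4 # replicate n 2) =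
           (\<Sum>l=0..n. (- 1) ^ l * mzv_star (replicate l 2 @ [4]) * mzv (replicate (n - l) 2))
       \<and> mzv_star (replicate b 2 @ [4]) =
           2 * alt_zeta (2 * b + 4)
           + 4 * (\<Sum>m. (harm (Suc m))\<^sup>2 / real (Suc m) ^ (2 * b + 2) * (- 1) ^ m)
           - 4 * (\<Sum>m. harm (Suc m) / real (Suc m) ^ (2 * b + 3) * (- 1) ^ m)
       \<and> (\<forall>k. mzv (replicate k 2) = pi ^ (2 * k) / fact (2 * k + 1))"
  using mzv_convolution[of n] mzv_star_eq_alternating_harm[of b] mzv_twos
  unfolding atMost_atLeast0 by blast

end
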